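(* Let $G$ be a graph on $n$ vertices with adjacency matrix $A$ and let $k \leq n$ be a positive integer. Suppose that the sequence $\{\mathrm{diff}_\ell\}$ is monotonically increasing in $G$. Let $\mu\in\mathbb{R}$ satisfy $\frac{\mu}{2} > \mathrm{diff}_k$ and let $x^* \in \{0,1\}^n$ be an optimal solution of (SkS). Then: (i) $$\frac{1}{2}x^{*T}Ax^* < \frac{1}{2}x^TAx + \frac{\mu}{2}(e^Tx-k)^2$$ for all $x \in \{0,1\}^n$ with $e^Tx \neq k$. (ii) Any optimal solution of (SkS-Q) with this $\mu$ is an optimal solution of (SkS).
   Context: Graphs are simple, undirected and finite, with vertex set $\{1,\dots,n\}$; $A$ is the adjacency matrix of $G$ and $e$ is the all-ones vector of length $n$. The sparsest $k$-subgraph problem is $$\text{(SkS)}\qquad \min\left\{\tfrac12 x^TAx \mid e^Tx=k,\ x\in\{0,1\}^n\right\}.$$ Its quadratic penalty relaxation with parameter $\mu>0$ is $$\text{(SkS-Q)}\qquad \min\left\{\tfrac12 x^TAx+\tfrac{\mu}{2}(e^Tx-k)^2 \mid x\in\{0,1\}^n\right\}.$$ For $\ell\in\{1,\dots,n\}$, $m_\ell := \min\{\tfrac12 x^TAx \mid e^Tx=\ell,\ x\in\{0,1\}^n\}$ is the minimum number of edges in an induced subgraph of $G$ on $\ell$ vertices. Set $\mathrm{diff}_1 := m_1 = 0$ and $\mathrm{diff}_\ell := m_\ell - m_{\ell-1}$ for $2\le\ell\le n$. The sequence $\{\mathrm{diff}_\ell\}$ is called monotonically increasing in $G$ if $\mathrm{diff}_\ell\le\mathrm{diff}_{\ell+1}$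 for all $\ell\in\{1,\dots,n-1\}$. *)

theory Defs
  imports "HOL-Analysis.Analysis" "Graph_Theory.Pair_Digraph"
begin

text \<open>A graph on \<open>n\<close> vertices is a \<^locale>\<open>pair_graph\<close> (finite, loop-free, symmetric arc relation)
  whose vertex set is all of a finite type \<open>'n\<close>, so that \<open>n = CARD('n)\<close> and vertices index vectors
  of type \<open>real ^ 'n\<close>. The all-ones vector is \<open>vec 1\<close>.\<close>

definition adj_matrix :: "'n::finite pair_pre_digraph \<Rightarrow> real ^ 'n ^ 'n" where
  "adj_matrix G = (\<chi> i j. if (i, j) \<in> parcs G then 1 else 0)"

definition half_quad :: "'n::finite pair_pre_digraph \<Rightarrow> real ^ 'n \<Rightarrow> real" where
  "half_quad G x = 1 / 2 * (x \<bullet> (adj_matrix G *v x))"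

definition binary_vecs :: "(real ^ 'n::finite) set" where
  "binary_vecs = {x. \<forall>i. x $ i \<in> {0, 1}}"

definition SkS_feasible :: "nat \<Rightarrow> (real ^ 'n::finite) set" where
  "SkS_feasible k = {x \<in> binary_vecs. vec 1 \<bullet> x = real k}"

definition SkS_optimal :: "'n::finite pair_pre_digraph \<Rightarrow> nat \<Rightarrow> real ^ 'n \<Rightarrow> bool" where
  "SkS_optimal G k x \<longleftrightarrow> is_arg_min (half_quad G) (\<lambda>y. y \<in> SkS_feasible k) x"

definition SkSQ_objective :: "'n::finite pair_pre_digraph \<Rightarrow> nat \<Rightarrow> real \<Rightarrow> real ^ 'n \<Rightarrow> real" where
  "SkSQ_objective G k \<mu> x = half_quad G x + \<mu> / 2 * (vec 1 \<bullet> x - real k)\<^sup>2"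

definition SkSQ_optimal :: "'n::finite pair_pre_digraph \<Rightarrow> nat \<Rightarrow> real \<Rightarrow> real ^ 'n \<Rightarrow> bool" where
  "SkSQ_optimal G k \<mu> x \<longleftrightarrow> is_arg_min (SkSQ_objective G k \<mu>) (\<lambda>y. y \<in> binary_vecs) x"

text \<open>Meaningful for \<open>l \<le> CARD('n)\<close>, where the feasible set is nonempty (it is always finite).\<close>

definition min_edges :: "'n::finite pair_pre_digraph \<Rightarrow> nat \<Rightarrow> real" where
  "min_edges G l = Min (half_quad G ` SkS_feasible l)"

text \<open>Only used for \<open>1 \<le> l \<le> CARD('n)\<close>.\<close>

definition edge_diff :: "'n::finite pair_pre_digraph \<Rightarrow> nat \<Rightarrow> real" where
  "edge_diff G l = (if l = 1 then min_edges G 1 else min_edges G l - min_edges G (l - 1))"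

definition edge_diff_increasing :: "'n::finite pair_pre_digraph \<Rightarrow> bool" where
  "edge_diff_increasing G \<longleftrightarrow> (\<forall>l\<in>{1..CARD('n) - 1}. edge_diff G l \<le> edge_diff G (l + 1))"

end

theory Submission
  imports Defs
begin

text \<open>Since \<open>m 0 = 0\<close>, monotonicity of the differences says that \<open>m\<close> is a convex sequence on
  \<open>{0..n}\<close>, so it lies above its supporting line at \<open>k\<close>: \<open>m l \<ge> m k + (l - k) * diff k\<close>. Writing
  \<open>t = l - k \<noteq> 0\<close>, the penalised objective at a vector with \<open>l\<close> ones is therefore at least
  \<open>m k + t * diff k + \<mu> / 2 * t\<^sup>2 > m k + diff k * (t + t\<^sup>2) \<ge> m k\<close>, because \<open>diff k \<ge> diff 1 \<ge> 0\<close>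
  and \<open>t + t\<^sup>2 \<ge> 0\<close> for an integer \<open>t\<close>.\<close>

lemma increasing_differences_supporting_line:
  fixes a d :: "nat \<Rightarrow> real"
  assumes step: "\<And>j. j < n \<Longrightarrow> a (Suc j) = a j + d (Suc j)"
    and mono: "\<And>i j. 1 \<le> i \<Longrightarrow> i \<le> j \<Longrightarrow> j \<le> n \<Longrightarrow> d i \<le> d j"
    and "1 \<le> k" "k \<le> n" "l \<le> n"
  shows "a k + (real l - real k) * d k \<le> a l"
proof (cases "l \<le> k")
  case True
  then show ?thesis
  proof (induction rule: inc_induct)
    case base
    then show ?case by simp
  next
    case (step j)
    \<comment> \<open>Going down from \<open>k\<close>, each step subtracts
      \<open>d (Suc j)\<close>, hence at most \<open>d k\<close>. Since \<open>Suc j\<close> is at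
      least 1, the descent may reach index 0.\<close>
    have "d (Suc j) \<le> d k"
      using step.hyps \<open>k \<le> n\<close> by (intro mono) auto
    moreover have "a (Suc j) = a j + d (Suc j)"
      using step.hyps \<open>k \<le> n\<close> by (intro assms(1)) auto
    ultimately show ?case
      using step.IH by (simp add: algebra_simps)
  qed
next
  case False
  then have "k \<le> l" by simp
  then show ?thesis
    using \<open>l \<le> n\<close>
  proof (induction rule: dec_induct)
    case base
    then show ?case by simp
  next
    case (step j)
    \<comment> \<open>Going up from \<open>k\<close>, each step adds at least
      \<open>d k\<close>.\<close>
    have "d k \<le> d (Suc j)"
      using step.hyps step.prems \<open>1 \<le> k\<close> by (intro mono) auto
    moreover have "a (Suc j) = a j + d (Suc j)"
      using step.prems by (intro assms(1)) auto
    ultimately show ?case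
      using step.IH step.prems by (simp add: algebra_simps)
  qed
qed

text \<open>Finiteness makes the \<open>Min\<close> in \<open>min_edges\<close> an attained lower
  bound. It holds because these vectors come from the finitely many functions into a two-element
  set.\<close>

lemma finite_binary_vecs: "finite (binary_vecs :: (real ^ 'n::finite) set)"
proof -
  have "(binary_vecs :: (real ^ 'n) set) \<subseteq> vec_lambda ` (UNIV \<rightarrow>\<^sub>E {0, 1})"
  proof
    fix x :: "real ^ 'n"
    assume "x \<in> binary_vecs"
    then have "vec_nth x \<in> UNIV \<rightarrow>\<^sub>E {0, 1}"
      by (auto simp: binary_vecs_def)
    then show "x \<in> vec_lambda ` (UNIV \<rightarrow>\<^sub>E {0, 1})"
      by (metis image_eqI vec_nth_inverse)
  qed
  then show ?thesis
    by (rule finite_subset) (intro finite_imageI finite_PiE, auto)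
qed

lemma finite_SkS_feasible: "finite (SkS_feasible l)"
  by (rule finite_subset[OF _ finite_binary_vecs]) (auto simp: SkS_feasible_def)

lemma SkS_feasible_binary: "x \<in> SkS_feasible l \<Longrightarrow> x \<in> binary_vecs"
  by (simp add: SkS_feasible_def)

lemma one_inner_vec: "1 \<bullet> x = (\<Sum>i\<in>UNIV. x $ i)" for x :: "real ^ 'n::finite"
  by (simp add: inner_vec_def)

text \<open>The level \<open>l\<close> is the size of the support: a sum of entries 0 and 1 counts
  the ones.\<close>

lemma binary_vecs_feasible:
  fixes x :: "real ^ 'n::finite"
  assumes "x \<in> binary_vecs"
  obtains l where "l \<le> CARD('n)" "x \<in> SkS_feasible l"
proof
  have "x $ i = (if x $ i = 1 then 1 else 0)" for i
    using assms by (auto simp: binary_vecs_def)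
  then have "(\<Sum>i\<in>UNIV. x $ i) = (\<Sum>i\<in>UNIV. if x $ i = 1 then 1 else 0)"
    by (intro sum.cong refl)
  also have "\<dots> = real (card {i. x $ i = 1})"
    by (simp add: sum.If_cases)
  finally show "x \<in> SkS_feasible (card {i. x $ i = 1})"
    using assms by (simp add: SkS_feasible_def one_inner_vec)
  show "card {i. x $ i = 1} \<le> CARD('n)"
    by (intro card_mono) auto
qed

lemma binary_vecs_nonneg:
  assumes "x \<in> binary_vecs"
  shows "0 \<le> x $ i"
proof -
  have "x $ i \<in> {0, 1}"
    using assms by (simp add: binary_vecs_def)
  then show ?thesis by auto
qed

lemma half_quad_nonneg:
  assumes "x \<in> binary_vecs"
  shows "0 \<le> half_quad G x"
  unfolding half_quad_def inner_vec_def matrix_vector_mult_def adj_matrix_def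
  by (auto intro!: sum_nonneg mult_nonneg_nonneg simp: binary_vecs_nonneg[OF assms])

lemma min_edges_le:
  assumes "x \<in> SkS_feasible l"
  shows "min_edges G l \<le> half_quad G x"
  unfolding min_edges_def using assms by (simp add: finite_SkS_feasible)

lemma SkS_optimal_min_edges:
  assumes "SkS_optimal G k x"
  shows "half_quad G x = min_edges G k"
proof -
  have "x \<in> SkS_feasible k" "\<And>y. y \<in> SkS_feasible k \<Longrightarrow> half_quad G x \<le> half_quad G y"
    using assms by (auto simp: SkS_optimal_def is_arg_min_linorder)
  then show ?thesis
    unfolding min_edges_def by (intro Min_eqI[symmetric]) (auto simp: finite_SkS_feasible)
qed

text \<open>The level 0 lies outside the range of the sequence of differences, but the zero vector
  is a competitor in the relaxed problem, so its value has to be known too.\<close>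

lemma min_edges_0: "min_edges G 0 = 0"
  for G :: "'n::finite pair_pre_digraph"
proof -
  have "x = 0" if "x \<in> SkS_feasible 0" for x :: "real ^ 'n"
  proof -
    have "0 \<le> x $ i" for i
      using that by (simp add: SkS_feasible_def binary_vecs_nonneg)
    moreover have "(\<Sum>i\<in>UNIV. x $ i) = 0"
      using that by (simp add: SkS_feasible_def one_inner_vec)
    ultimately show ?thesis
      by (simp add: sum_nonneg_eq_0_iff vec_eq_iff)
  qed
  moreover have "0 \<in> (SkS_feasible 0 :: (real ^ 'n) set)"
    by (simp add: SkS_feasible_def binary_vecs_def)
  ultimately have "SkS_feasible 0 = {0 :: real ^ 'n}"
    by blast
  then show ?thesis
    by (simp add: min_edges_def half_quad_def)
qed

lemma edge_diff_1_nonneg: "0 \<le> edge_diff G 1"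
  for G :: "'n::finite pair_pre_digraph"
proof -
  \<comment> \<open>The unit vector at an arbitrary vertex shows that the minimum is over a nonempty
    set.\<close>
  have "axis undefined 1 \<in> (SkS_feasible 1 :: (real ^ 'n) set)"
    by (simp add: SkS_feasible_def binary_vecs_def one_inner_vec axis_def)
  then have "0 \<le> min_edges G 1"
    unfolding min_edges_def
    by (subst Min_ge_iff) (auto simp: finite_SkS_feasible dest: SkS_feasible_binary intro: half_quad_nonneg)
  then show ?thesis
    by (simp add: edge_diff_def)
qed

text \<open>The special clause for \<open>edge_diff G 1\<close> fits the general recurrence because
  \<open>min_edges G 0\<close> vanishes.\<close>

lemma min_edges_Suc: "min_edges G (Suc j) = min_edges G j + edge_diff G (Suc j)"
  by (cases j) (auto simp: edge_diff_def min_edges_0)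

lemma edge_diff_mono:
  fixes G :: "'n::finite pair_pre_digraph"
  assumes inc: "edge_diff_increasing G" and "1 \<le> i" "i \<le> j" "j \<le> CARD('n)"
  shows "edge_diff G i \<le> edge_diff G j"
  using \<open>i \<le> j\<close> \<open>j \<le> CARD('n)\<close>
proof (induction rule: dec_induct)
  case base
  then show ?case by simp
next
  case (step j)
  then have "edge_diff G j \<le> edge_diff G (j + 1)"
    using inc \<open>1 \<le> i\<close> by (simp add: edge_diff_increasing_def)
  then show ?case
    using step by simp
qed

lemma min_edges_less_objective:
  fixes G :: "'n::finite pair_pre_digraph"
  assumes k: "1 \<le> k" "k \<le> CARD('n)" and inc: "edge_diff_increasing G"
    and \<mu>: "edge_diff G k < \<mu> / 2"
    and x: "x \<in> binary_vecs" "vec 1 \<bullet> x \<noteq> real k"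
  shows "min_edges G k < SkSQ_objective G k \<mu> x"
proof -
  obtain l where l: "l \<le> CARD('n)" "x \<in> SkS_feasible l"
    using binary_vecs_feasible x(1) by blast
  define d where "d = edge_diff G k"
  define t where "t = int l - int k"
  have t: "real l - real k = of_int t" "vec 1 \<bullet> x - real k = of_int t"
    using l(2) by (auto simp: t_def SkS_feasible_def)
  then have "t \<noteq> 0"
    using x(2) by auto
  have "0 \<le> d"
    unfolding d_def using edge_diff_1_nonneg edge_diff_mono[OF inc] k by (meson order.trans order.refl)
  moreover have "0 \<le> t + t\<^sup>2"
  proof -
    \<comment> \<open>Consecutive integers never have opposite signs. This fails for reals strictly
      between -1 and 0, which is why \<open>t\<close> is an \<open>int\<close>.\<close>
    have "0 \<le> t * (t + 1)"
      by (auto simp: zero_le_mult_iff)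
    then show ?thesis
      by (simp add: algebra_simps power2_eq_square)
  qed
  then have "(0::real) \<le> of_int t + (of_int t)\<^sup>2"
    by (simp flip: of_int_power of_int_add)
  ultimately have "0 \<le> d * (of_int t + (of_int t)\<^sup>2)"
    by simp
  \<comment> \<open>The only strict inequality of the chain: the gap between \<open>d\<close> and
    \<open>\<mu> / 2\<close> is multiplied by a nonzero square.\<close>
  moreover have "d * (of_int t)\<^sup>2 < \<mu> / 2 * (of_int t)\<^sup>2"
    using \<mu> \<open>t \<noteq> 0\<close> by (intro mult_strict_right_mono) (auto simp: d_def)
  moreover have "min_edges G k + of_int t * d \<le> min_edges G l"
    using increasing_differences_supporting_line[of "CARD('n)" "min_edges G" "edge_diff G",
        OF min_edges_Suc edge_diff_mono[OF inc] k l(1)]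
    by (simp add: t(1) d_def)
  moreover have "min_edges G l \<le> half_quad G x"
    using l(2) by (rule min_edges_le)
  ultimately show ?thesis
    unfolding SkSQ_objective_def t(2) by (simp add: algebra_simps)
qed

theorem lemma5:
  fixes G :: "'n::finite pair_pre_digraph" and k :: nat and \<mu> :: real and xs :: "real ^ 'n"
  assumes "pair_graph G" and "pverts G = UNIV"
    and "1 \<le> k" and "k \<le> CARD('n)"
    and "edge_diff_increasing G"
    and "\<mu> / 2 > edge_diff G k"
    and "SkS_optimal G k xs"
  shows "(\<forall>x \<in> binary_vecs. vec 1 \<bullet> x \<noteq> real k \<longrightarrow>
            1 / 2 * (xs \<bullet> (adj_matrix G *v xs))
              < 1 / 2 * (x \<bullet> (adj_matrix G *v x)) + \<mu> / 2 * (vec 1 \<bullet> x - real k)\<^sup>2)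
       \<and> (\<forall>x. SkSQ_optimal G k \<mu> x \<longrightarrow> SkS_optimal G k x)"
proof (intro conjI ballI allI impI)
  note less = min_edges_less_objective[OF assms(3-6)]
  fix x :: "real ^ 'n"
  {
    assume "x \<in> binary_vecs" "vec 1 \<bullet> x \<noteq> real k"
    then show "1 / 2 * (xs \<bullet> (adj_matrix G *v xs))
        < 1 / 2 * (x \<bullet> (adj_matrix G *v x)) + \<mu> / 2 * (vec 1 \<bullet> x - real k)\<^sup>2"
      using less[of x] SkS_optimal_min_edges[OF assms(7)]
      by (simp add: SkSQ_objective_def half_quad_def)
  }
  have feasible: "y \<in> binary_vecs" "SkSQ_objective G k \<mu> y = half_quad G y"
    if "y \<in> SkS_feasible k" for y
    using that by (auto simp: SkS_feasible_def SkSQ_objective_def)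
  assume "SkSQ_optimal G k \<mu> x"
  then have x: "x \<in> binary_vecs"
    "\<And>y. y \<in> binary_vecs \<Longrightarrow> SkSQ_objective G k \<mu> x \<le> SkSQ_objective G k \<mu> y"
    by (auto simp: SkSQ_optimal_def is_arg_min_linorder)
  have xs: "xs \<in> SkS_feasible k"
    using assms(7) by (simp add: SkS_optimal_def is_arg_min_def)
  \<comment> \<open>Otherwise \<open>x\<close> would have a penalised value above
    \<open>min_edges G k\<close>, which \<open>xs\<close> attains with zero penalty.\<close>
  have "vec 1 \<bullet> x = real k"
    using less[OF x(1)] x(2)[OF feasible(1)[OF xs]] feasible(2)[OF xs]
      SkS_optimal_min_edges[OF assms(7)] by fastforce
  then have "x \<in> SkS_feasible k"
    using x(1) by (simp add: SkS_feasible_def)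
  \<comment> \<open>Both objectives agree on \<open>SkS_feasible k\<close>, so minimality over all
    of \<open>binary_vecs\<close> restricts to it.\<close>
  then show "SkS_optimal G k x"
    unfolding SkS_optimal_def is_arg_min_linorder using x(2) feasible by metis
qed

end
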